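(* Let $\Phi:\mathbb{M}(n)\to\mathbb{M}(k)$ be a positive unital linear map, and let $A\in\mathbb{M}(n)$ be positive definite. Then $$\begin{bmatrix}\Phi(A^2)&\Phi(A)\\ \Phi(A)&\Phi(A-\log A)\end{bmatrix}\ge O.$$
   Context: $\mathbb{M}(n)$ is the $C^*$-algebra of all $n\times n$ complex matrices. A linear map $\Phi:\mathbb{M}(n)\to\mathbb{M}(k)$ is positive if it sends positive semidefinite matrices to positive semidefinite matrices, and unital if $\Phi(I)=I$. $X\ge O$ means $X$ is Hermitian positive semidefinite; the displayed $2\times 2$ block matrix is viewed as an element of $\mathbb{M}(2k)$. Positive definite matrices are Hermitian, and $\log A$ is defined by the functional calculus (natural logarithm applied to the eigenvalues of $A$). *)

theory Defs
  imports "HOL-Analysis.Analysis"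
begin

text \<open>
  The algebra of complex matrices of a fixed size is \<open>complex^'n^'n\<close>, with product \<open>**\<close> and
  identity \<open>mat 1\<close> (the type's own \<open>*\<close> and \<open>1\<close> are entrywise and are not used).
\<close>

definition mscale :: "complex \<Rightarrow> complex^'n^'m \<Rightarrow> complex^'n^'m"  (infixr "*m" 75)
  where "c *m A = (\<chi> i j. c * A $ i $ j)"

lemma vector_space_mscale: "vector_space ((*m) :: complex \<Rightarrow> complex^'n^'m \<Rightarrow> _)"
  by unfold_locales (auto simp: mscale_def vec_eq_iff algebra_simps)

definition adj :: "complex^'n^'m \<Rightarrow> complex^'m^'n"
  where "adj A = (\<chi> i j. cnj (A $ j $ i))"

definition hermitian :: "complex^'n^'n \<Rightarrow> bool"
  where "hermitian A \<longleftrightarrow> adj A = A"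

definition unitary :: "complex^'n^'n \<Rightarrow> bool"
  where "unitary U \<longleftrightarrow> adj U ** U = mat 1 \<and> U ** adj U = mat 1"

definition quad_form :: "complex^'n^'n \<Rightarrow> complex^'n \<Rightarrow> complex"
  where "quad_form A x = (\<Sum>i\<in>UNIV. cnj (x $ i) * (A *v x) $ i)"

text \<open>The quadratic form of a Hermitian matrix is real, so \<open>Re\<close> loses nothing below.\<close>

lemma quad_form_real:
  assumes "hermitian A"
  shows "quad_form A x \<in> \<real>"
proof -
  have h: "cnj (A $ i $ j) = A $ j $ i" for i j
    using assms by (metis (no_types, lifting) adj_def hermitian_def vec_lambda_beta)
  have eq: "quad_form A x = (\<Sum>i\<in>UNIV. \<Sum>j\<in>UNIV. cnj (x $ i) * A $ i $ j * x $ j)"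
    by (simp add: quad_form_def matrix_vector_mult_def sum_distrib_left mult.assoc)
  have "cnj (quad_form A x) = (\<Sum>i\<in>UNIV. \<Sum>j\<in>UNIV. cnj (x $ j) * A $ j $ i * x $ i)"
    by (simp add: eq h mult_ac)
  also have "\<dots> = quad_form A x"
    unfolding eq by (rule sum.swap)
  finally show ?thesis
    by (simp add: Reals_cnj_iff)
qed

definition psd :: "complex^'n^'n \<Rightarrow> bool"
  where "psd A \<longleftrightarrow> hermitian A \<and> (\<forall>x. 0 \<le> Re (quad_form A x))"

definition posdef :: "complex^'n^'n \<Rightarrow> bool"
  where "posdef A \<longleftrightarrow> hermitian A \<and> (\<forall>x. x \<noteq> 0 \<longrightarrow> 0 < Re (quad_form A x))"

definition diag :: "('n \<Rightarrow> complex) \<Rightarrow> complex^'n^'n"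
  where "diag d = (\<chi> i j. if i = j then d i else 0)"

text \<open>
  Functional calculus for a Hermitian matrix: if \<open>A = U diag(d) U\<^sup>*\<close> with \<open>U\<close> unitary and
  \<open>d\<close> real, then \<open>f(A) = U diag(f \<circ> d) U\<^sup>*\<close>. Such a diagonalisation exists by the spectral
  theorem, and the result does not depend on it by \<open>spectral_image_unique\<close>.
\<close>

definition spectral_image :: "(real \<Rightarrow> real) \<Rightarrow> complex^'n^'n \<Rightarrow> complex^'n^'n \<Rightarrow> bool"
  where "spectral_image f A B \<longleftrightarrow>
    (\<exists>U d. unitary U \<and> A = U ** diag (\<lambda>i. complex_of_real (d i)) ** adj U
                    \<and> B = U ** diag (\<lambda>i. complex_of_real (f (d i))) ** adj U)"

lemma diag_mult_nth:
  "(diag d ** M) $ i $ j = d i * M $ i $ j"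
  "(M ** diag d) $ i $ j = M $ i $ j * d j"
  by (simp_all add: diag_def matrix_matrix_mult_def if_distrib[of "\<lambda>x. x * _"]
      if_distrib[of "\<lambda>x. _ * x"] cong: if_cong)

lemma spectral_image_unique:
  assumes "spectral_image f A B" and "spectral_image f A C"
  shows "B = C"
proof -
  obtain U d where U: "unitary U"
    and A1: "A = U ** diag (\<lambda>i. complex_of_real (d i)) ** adj U"
    and B: "B = U ** diag (\<lambda>i. complex_of_real (f (d i))) ** adj U"
    using assms(1) unfolding spectral_image_def by blast
  obtain V e where V: "unitary V"
    and A2: "A = V ** diag (\<lambda>i. complex_of_real (e i)) ** adj V"
    and C: "C = V ** diag (\<lambda>i. complex_of_real (f (e i))) ** adj V"
    using assms(2) unfolding spectral_image_def by blast
  have U': "adj U ** U = mat 1" "U ** adj U = mat 1"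
    and V': "adj V ** V = mat 1" "V ** adj V = mat 1"
    using U V by (auto simp: unitary_def)
  define W where "W = adj V ** U"
  have left: "adj V ** (U ** X ** adj U) ** U = W ** X" for X
    by (metis U'(1) W_def matrix_mul_assoc matrix_mul_rid)
  have right: "adj V ** (V ** X ** adj V) ** U = X ** W" for X
    by (metis V'(1) W_def matrix_mul_assoc matrix_mul_lid)
  have "W ** diag (\<lambda>i. complex_of_real (d i)) = diag (\<lambda>i. complex_of_real (e i)) ** W"
    using left right A1 A2 by metis
  then have "W $ i $ j * complex_of_real (d j) = complex_of_real (e i) * W $ i $ j" for i j
    by (metis diag_mult_nth)
  then have "W $ i $ j = 0 \<or> d j = e i" for i j
    by (metis mult.commute mult_left_cancel of_real_eq_iff)
  then have "W $ i $ j * complex_of_real (f (d j)) = complex_of_real (f (e i)) * W $ i $ j" for i j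
    by (metis mult.commute mult_zero_left)
  then have "W ** diag (\<lambda>i. complex_of_real (f (d i))) = diag (\<lambda>i. complex_of_real (f (e i))) ** W"
    by (simp add: vec_eq_iff diag_mult_nth)
  then have "adj V ** B ** U = adj V ** C ** U"
    using left right B C by metis
  then have "V ** (adj V ** B ** U) ** adj U = V ** (adj V ** C ** U) ** adj U"
    by simp
  then show ?thesis
    by (metis U'(2) V'(2) matrix_mul_assoc matrix_mul_lid matrix_mul_rid)
qed

definition mfun :: "(real \<Rightarrow> real) \<Rightarrow> complex^'n^'n \<Rightarrow> complex^'n^'n"
  where "mfun f A = (THE B. spectral_image f A B)"

abbreviation mlog :: "complex^'n^'n \<Rightarrow> complex^'n^'n"
  where "mlog \<equiv> mfun ln"

text \<open>Linearity is over the complex numbers.\<close>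

definition positive_unital_linear :: "(complex^'n^'n \<Rightarrow> complex^'k^'k) \<Rightarrow> bool"
  where "positive_unital_linear \<Phi> \<longleftrightarrow>
    Vector_Spaces.linear (*m) (*m) \<Phi> \<and> (\<forall>X. psd X \<longrightarrow> psd (\<Phi> X)) \<and> \<Phi> (mat 1) = mat 1"

text \<open>The rows and columns of a 2-by-2 block matrix with blocks of size \<open>'k\<close> are indexed by
  \<open>'k + 'k\<close>: \<open>Inl\<close> is the first block, \<open>Inr\<close> the second.\<close>

definition block_mat ::
    "complex^'k^'k \<Rightarrow> complex^'k^'k \<Rightarrow> complex^'k^'k \<Rightarrow> complex^'k^'k \<Rightarrow> complex^('k + 'k)^('k + 'k)"
  where "block_mat P Q R S = (\<chi> i j.
    case i of Inl a \<Rightarrow> (case j of Inl b \<Rightarrow> P $ a $ b | Inr b \<Rightarrow> Q $ a $ b)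
            | Inr a \<Rightarrow> (case j of Inl b \<Rightarrow> R $ a $ b | Inr b \<Rightarrow> S $ a $ b))"

end

theory Submission
  imports Defs
begin

text \<open>
  Diagonalise \<open>A = \<Sum>\<^sub>i d\<^sub>i P\<^sub>i\<close> with spectral projections \<open>P\<^sub>i\<close> and \<open>d\<^sub>i > 0\<close>. By linearity the
  block matrix is the sum over \<open>i\<close> of the tensor products of the real \<open>2 \<times> 2\<close> matrix with rows
  \<open>(d\<^sub>i\<^sup>2, d\<^sub>i)\<close> and \<open>(d\<^sub>i, d\<^sub>i - ln d\<^sub>i)\<close> with \<open>\<Phi> P\<^sub>i \<ge> 0\<close>. The former is positive semidefinite
  because \<open>d\<^sub>i - ln d\<^sub>i \<ge> 1\<close>.
\<close>

section \<open>The Hermitian inner product\<close>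

text \<open>Conjugate-linear in the first argument. Its real part is the real inner product of
  \<open>complex^'n\<close>, so results on real Euclidean spaces become available.\<close>

definition hinner :: "complex^'n \<Rightarrow> complex^'n \<Rightarrow> complex"
  where "hinner x y = (\<Sum>i\<in>UNIV. cnj (x $ i) * y $ i)"

lemma Re_hinner: "Re (hinner x y) = x \<bullet> y"
  by (simp add: hinner_def inner_vec_def inner_complex_def)

lemma cnj_hinner: "cnj (hinner x y) = hinner y x"
  by (simp add: hinner_def mult.commute)

lemma hinner_add: "hinner x (y + z) = hinner x y + hinner x z"
  "hinner (x + y) z = hinner x z + hinner y z"
  by (simp_all add: hinner_def algebra_simps sum.distrib)

lemma hinner_smult: "hinner x (c *s y) = c * hinner x y" "hinner (c *s x) y = cnj c * hinner x y"
  by (simp_all add: hinner_def sum_distrib_left algebra_simps)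

lemma hinner_scaleR: "hinner x (r *\<^sub>R y) = of_real r * hinner x y"
  by (simp add: hinner_def sum_distrib_left scaleR_conv_of_real[where 'a = complex] algebra_simps)

lemma hinner_self: "hinner x x = of_real (x \<bullet> x)"
  by (simp add: complex_eq_iff Re_hinner)
    (metis Reals_cnj_iff cnj_hinner complex_is_Real_iff)

lemma hinner_matrix_vector_mult: "hinner x (A *v y) = hinner (adj A *v x) y"
  unfolding hinner_def matrix_vector_mult_def adj_def
  by (simp add: sum_distrib_left sum_distrib_right) (subst sum.swap, simp add: mult_ac)

lemma quad_form_eq_hinner: "quad_form A x = hinner x (A *v x)"
  by (simp add: quad_form_def hinner_def)

lemma hermitian_hinner:
  assumes "hermitian A"
  shows "hinner (A *v x) y = hinner x (A *v y)"
  using assms by (simp add: hinner_matrix_vector_mult hermitian_def)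

lemma matrix_vector_mult_scaleR: "A *v (r *\<^sub>R x) = r *\<^sub>R (A *v (x :: complex^'n))"
  by (simp add: vec_eq_iff matrix_vector_mult_def scaleR_sum_right)

section \<open>The spectral theorem\<close>

text \<open>For small t of sign opposite to \<open>a\<close>, the linear term would outweigh the
  quadratic one.\<close>

lemma quadratic_nonneg_imp_linear_coeff_zero:
  fixes a b :: real
  assumes "\<And>t. 0 \<le> 2 * t * a + t\<^sup>2 * b"
  shows "a = 0"
proof (rule ccontr)
  assume a: "a \<noteq> 0"
  \<comment> \<open>A positive number strictly above \<open>b\<close>: at t = -a/c the expression is
    then less than -a^2/c.\<close>
  define c where "c = \<bar>b\<bar> + 1"
  have c: "c > 0" "b < c" by (auto simp: c_def)
  have "0 \<le> 2 * (- a / c) * a + (- a / c)\<^sup>2 * b" by (rule assms)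
  also have "\<dots> < 2 * (- a / c) * a + (- a / c)\<^sup>2 * c"
    using a c by (intro add_strict_left_mono mult_strict_left_mono) auto
  also have "\<dots> = - (a\<^sup>2 / c)" using c by (simp add: field_simps power2_eq_square)
  finally show False using c by (smt (verit) divide_nonneg_pos zero_le_power2)
qed

text \<open>A maximiser of the Rayleigh quotient on the compact unit sphere of \<open>W\<close> is
  an eigenvector, with the maximum as eigenvalue.\<close>

lemma selfadjoint_eigenvector_in_subspace:
  fixes f :: "'a::euclidean_space \<Rightarrow> 'a"
  assumes lin: "linear f" and self: "\<And>x y. f x \<bullet> y = x \<bullet> f y"
    and W: "subspace W" and inv: "f ` W \<subseteq> W" and ne: "w \<in> W" "w \<noteq> 0"
  obtains v \<mu> where "v \<in> W" "norm v = 1" "f v = \<mu> *\<^sub>R v"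
proof -
  let ?S = "sphere 0 1 \<inter> W"
  have "compact ?S" by (intro compact_Int_closed closed_subspace W) auto
  moreover have "w /\<^sub>R norm w \<in> ?S"
    using ne W by (auto simp: subspace_scale)
  moreover have "continuous_on ?S (\<lambda>x. x \<bullet> f x)"
    by (intro continuous_intros linear_continuous_on linear_conv_bounded_linear[THEN iffD1] lin)
  ultimately obtain v where v: "v \<in> ?S" and max: "\<And>x. x \<in> ?S \<Longrightarrow> x \<bullet> f x \<le> v \<bullet> f v"
    using continuous_attains_sup[of ?S "\<lambda>x. x \<bullet> f x"] by blast
  define \<mu> where "\<mu> = v \<bullet> f v"
  \<comment> \<open>The form of \<open>g\<close> is nonnegative on \<open>W\<close> by maximality
    and vanishes at \<open>v\<close>; the aim is \<open>g v = 0\<close>.\<close>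
  define g where "g x = \<mu> *\<^sub>R x - f x" for x
  have nonneg: "0 \<le> x \<bullet> g x" if "x \<in> W" for x
  proof (cases "x = 0")
    case False
    with that W have "x /\<^sub>R norm x \<in> ?S" by (auto simp: subspace_scale)
    from max[OF this] have "(x \<bullet> f x) / (norm x)\<^sup>2 \<le> \<mu>"
      by (simp add: linear_cmul[OF lin] \<mu>_def power2_eq_square divide_simps)
    with False show ?thesis
      by (simp add: g_def inner_diff_right power2_norm_eq_inner divide_simps split: if_splits)
  qed simp
  have vv: "v \<bullet> v = 1" using v by (simp add: dot_square_norm)
  have gv: "v \<bullet> g v = 0" by (simp add: g_def inner_diff_right vv \<mu>_def)
  have gself: "g x \<bullet> y = x \<bullet> g y" for x y
    by (simp add: g_def inner_diff_left inner_diff_right self)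
  have gadd: "g (x + t *\<^sub>R y) = g x + t *\<^sub>R g y" for x y t
    by (simp add: g_def linear_add[OF lin] linear_cmul[OF lin] algebra_simps)
  have gW: "g v \<in> W"
    using v inv W by (auto simp: g_def intro!: subspace_diff subspace_scale)
  \<comment> \<open>Perturb \<open>v\<close> in the direction \<open>g v\<close>, which stays in
    \<open>W\<close>. The form has no constant term in t there, so its linear coefficient must
    vanish.\<close>
  have "g v \<bullet> g v = 0"
  proof (rule quadratic_nonneg_imp_linear_coeff_zero)
    fix t :: real
    have "0 \<le> (v + t *\<^sub>R g v) \<bullet> g (v + t *\<^sub>R g v)"
      using v gW W by (intro nonneg subspace_add subspace_scale) auto
    also have "\<dots> = 2 * t * (g v \<bullet> g v) + t\<^sup>2 * (g v \<bullet> g (g v))"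
      unfolding gadd using gv gself[of v "g v"]
      by (simp add: inner_add_left inner_add_right power2_eq_square distrib_left mult.assoc)
    finally show "0 \<le> 2 * t * (g v \<bullet> g v) + t\<^sup>2 * (g v \<bullet> g (g v))" .
  qed
  then have "f v = \<mu> *\<^sub>R v" by (simp add: g_def)
  with v that show ?thesis by auto
qed

text \<open>A dimension count: the spare index \<open>k\<close> leaves fewer conditions than
  coordinates. The map \<open>h\<close> collecting the conditions has zero \<open>k\<close>-th
  coordinate, so it is not surjective and hence not injective.\<close>

lemma exists_nonzero_hinner_orthogonal:
  fixes v :: "'n \<Rightarrow> complex^'n"
  assumes "k \<notin> S"
  obtains w where "w \<noteq> 0" "\<forall>i\<in>S. hinner (v i) w = 0"
proof -
  define h where "h x = (\<chi> i. if i \<in> S then hinner (v i) x else 0)" for x :: "complex^'n"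
  have lin: "linear h"
    by (rule linearI)
      (auto simp: h_def vec_eq_iff hinner_add hinner_scaleR scaleR_conv_of_real[where 'a = complex])
  have "axis k 1 \<notin> range h"
    using assms by (auto simp: h_def axis_def vec_eq_iff dest!: spec[of _ k])
  then have "\<not> surj h" by auto
  then have "\<not> inj h" using linear_injective_imp_surjective[OF lin] by blast
  then obtain w where "h w = 0" "w \<noteq> 0" using linear_injective_0[OF lin] by blast
  then show ?thesis by (intro that[of w]) (auto simp: h_def vec_eq_iff split: if_splits)
qed

text \<open>Induction on \<open>S\<close>: the orthogonal complement of the eigenvectors found so
  far is nonzero and invariant under the Hermitian \<open>A\<close>, so it contains another one.
  Indexing by the coordinate type makes \<open>S = UNIV\<close> yield a full basis.\<close>

lemma hermitian_orthonormal_eigenvectors: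
  fixes A :: "complex^'n^'n"
  assumes A: "hermitian A"
  shows "\<exists>v (d :: 'n \<Rightarrow> real). (\<forall>i\<in>S. \<forall>j\<in>S. hinner (v i) (v j) = (if i = j then 1 else 0)) \<and>
           (\<forall>i\<in>S. A *v v i = d i *\<^sub>R v i)"
proof -
  have "finite S" by simp
  then show ?thesis
  proof (induction S rule: finite_induct)
    case (insert k S)
    then obtain v and d :: "'n \<Rightarrow> real"
      where orth: "\<And>i j. i \<in> S \<Longrightarrow> j \<in> S \<Longrightarrow> hinner (v i) (v j) = (if i = j then 1 else 0)"
        and eig: "\<And>i. i \<in> S \<Longrightarrow> A *v v i = d i *\<^sub>R v i"
      by metis
    define W where "W = {x. \<forall>i\<in>S. hinner (v i) x = 0}"
    have sub: "subspace W"
      by (auto simp: subspace_def W_def hinner_add hinner_scaleR) (simp add: hinner_def)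
    have inv: "(*v) A ` W \<subseteq> W"
    proof -
      have "hinner (v i) (A *v x) = 0" if "x \<in> W" "i \<in> S" for i x
      proof -
        have "cnj (hinner (v i) (A *v x)) = hinner x (A *v v i)"
          by (simp add: cnj_hinner hermitian_hinner[OF A])
        also have "\<dots> = of_real (d i) * cnj (hinner (v i) x)"
          by (simp add: eig that hinner_scaleR cnj_hinner)
        finally show ?thesis using that by (simp add: W_def)
      qed
      then show ?thesis by (auto simp: W_def)
    qed
    obtain w where w: "w \<noteq> 0" "w \<in> W"
      using exists_nonzero_hinner_orthogonal[OF insert.hyps(2), of v] by (auto simp: W_def)
    have lin: "linear ((*v) A)"
      by (rule linearI) (simp_all add: matrix_vector_right_distrib matrix_vector_mult_scaleR)
    have self: "(A *v x) \<bullet> y = x \<bullet> (A *v y)" for x y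
      by (metis Re_hinner hermitian_hinner[OF A])
    \<comment> \<open>The eigenvector is found over the reals, so \<mu> is real. Complex
      orthogonality to the earlier vectors comes from membership in \<open>W\<close>.\<close>
    obtain u \<mu> where u: "u \<in> W" "norm u = 1" "A *v u = \<mu> *\<^sub>R u"
      using selfadjoint_eigenvector_in_subspace[OF lin self sub inv w(2,1)] by blast
    have uu: "hinner u u = 1" using u by (simp add: hinner_self dot_square_norm)
    have vu: "hinner (v i) u = 0" "hinner u (v i) = 0" if "i \<in> S" for i
      using u that cnj_hinner[of "v i" u] by (auto simp: W_def)
    show ?case
      using insert.hyps(2) orth eig u(3) uu vu
      by (intro exI[of _ "v(k := u)"] exI[of _ "d(k := \<mu>)"]) auto
  qed simp
qed

lemma column_matrix_mult: "column j (A ** B) = A *v column j B"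
  by (simp add: column_def matrix_matrix_mult_def matrix_vector_mult_def vec_eq_iff)

text \<open>The orthonormal eigenvectors become the columns of \<open>U\<close>. The eigenvector
  equation is kept as a conclusion for determining the sign of \<open>d i\<close>.\<close>

lemma hermitian_spectral_theorem:
  fixes A :: "complex^'n^'n"
  assumes "hermitian A"
  obtains U and d :: "'n \<Rightarrow> real"
  where "unitary U" "A = U ** diag (\<lambda>i. complex_of_real (d i)) ** adj U"
    "\<And>i. A *v column i U = d i *\<^sub>R column i U"
proof -
  obtain v and d :: "'n \<Rightarrow> real"
    where orth: "\<And>i j. hinner (v i) (v j) = (if i = j then 1 else 0)"
      and eig: "\<And>i. A *v v i = d i *\<^sub>R v i"
    using hermitian_orthonormal_eigenvectors[OF assms, of UNIV] by auto
  define U where "U = (\<chi> i j. v j $ i)"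
  have col: "column j U = v j" for j by (simp add: column_def U_def)
  have "adj U ** U = mat 1"
    using orth
    by (simp add: vec_eq_iff matrix_matrix_mult_def adj_def U_def mat_def hinner_def)
  \<comment> \<open>A one-sided inverse of a square matrix is two-sided.\<close>
  moreover from this have UU: "U ** adj U = mat 1" by (simp add: matrix_left_right_inverse)
  ultimately have "unitary U" by (simp add: unitary_def)
  have "(A ** U) $ i $ j = (U ** diag (\<lambda>i. complex_of_real (d i))) $ i $ j" for i j
  proof -
    have "(A ** U) $ i $ j = column j (A ** U) $ i" by (simp add: column_def)
    then show ?thesis
      unfolding column_matrix_mult col eig diag_mult_nth
      by (simp add: U_def scaleR_conv_of_real[where 'a = complex])
  qed
  then have "A ** U = U ** diag (\<lambda>i. complex_of_real (d i))" by (simp add: vec_eq_iff)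
  then have "A = U ** diag (\<lambda>i. complex_of_real (d i)) ** adj U"
    by (metis UU matrix_mul_assoc matrix_mul_rid)
  with \<open>unitary U\<close> eig show ?thesis by (intro that[of U d]) (simp_all add: col)
qed

lemma posdef_spectral_theorem:
  fixes A :: "complex^'n^'n"
  assumes "posdef A"
  obtains U and d :: "'n \<Rightarrow> real"
  where "unitary U" "A = U ** diag (\<lambda>i. complex_of_real (d i)) ** adj U" "\<And>i. 0 < d i"
proof -
  have "hermitian A" using assms by (simp add: posdef_def)
  then obtain U and d :: "'n \<Rightarrow> real"
    where U: "unitary U" and A: "A = U ** diag (\<lambda>i. complex_of_real (d i)) ** adj U"
      and eig: "\<And>i. A *v column i U = d i *\<^sub>R column i U"
    using hermitian_spectral_theorem by metis
  have "0 < d i" for i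
  proof -
    \<comment> \<open>\<open>adj U\<close> sends column \<open>i\<close> of \<open>U\<close> to a
      column of the identity, so that column is nonzero. The form of \<open>A\<close> there is
      \<open>d i\<close> times its squared norm.\<close>
    have "column i (adj U ** U) \<noteq> 0"
      using U by (auto simp: unitary_def column_def mat_def vec_eq_iff)
    then have "column i U \<noteq> 0" by (auto simp: column_matrix_mult)
    then have "0 < Re (quad_form A (column i U))" "0 < column i U \<bullet> column i U"
      using assms by (simp_all add: posdef_def)
    moreover from this(1) have "0 < d i * (column i U \<bullet> column i U)"
      by (simp add: quad_form_eq_hinner eig hinner_scaleR Re_hinner)
    ultimately show ?thesis by (metis zero_less_mult_pos2)
  qed
  with U A that show ?thesis by blast
qed

text \<open>The given diagonalisation witnesses \<open>spectral_image\<close>, and uniqueness makes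
  the definite description evaluate to it.\<close>

lemma mfun_unitary_diag:
  assumes "unitary U"
  shows "mfun f (U ** diag (\<lambda>i. complex_of_real (d i)) ** adj U) =
         U ** diag (\<lambda>i. complex_of_real (f (d i))) ** adj U"
proof -
  have "spectral_image f (U ** diag (\<lambda>i. complex_of_real (d i)) ** adj U)
         (U ** diag (\<lambda>i. complex_of_real (f (d i))) ** adj U)"
    using assms by (auto simp: spectral_image_def)
  then show ?thesis
    unfolding mfun_def by (metis (no_types, lifting) spectral_image_unique the_equality)
qed

section \<open>Spectral projections\<close>

text \<open>For unitary \<open>U\<close>, the rank-one projection u u* onto the \<open>k\<close>-th
  column u. There is one per index, so repeated eigenvalues need no grouping.\<close>

definition spec_proj :: "complex^'n^'n \<Rightarrow> 'n \<Rightarrow> complex^'n^'n"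
  where "spec_proj U k = (\<chi> i j. U $ i $ k * cnj (U $ j $ k))"

lemma unitary_diag_eq_sum_spec_proj:
  "U ** diag c ** adj U = (\<Sum>k\<in>UNIV. c k *m spec_proj U k)"
proof -
  have "(U ** diag c ** adj U) $ i $ j = (\<Sum>k\<in>UNIV. (U ** diag c) $ i $ k * cnj (U $ j $ k))" for i j
    by (simp add: matrix_matrix_mult_def adj_def)
  then show ?thesis
    by (simp add: vec_eq_iff diag_mult_nth mscale_def spec_proj_def mult_ac)
qed

text \<open>Its quadratic form at x is the squared modulus of the inner product of x with the
  column.\<close>

lemma psd_spec_proj: "psd (spec_proj U k)"
proof -
  have "quad_form (spec_proj U k) x = hinner x (column k U) * hinner (column k U) x" for x
    by (simp add: quad_form_def hinner_def matrix_vector_mult_def spec_proj_def column_def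
        sum_product sum_distrib_left mult_ac)
  also have "\<dots> x = of_real ((cmod (hinner x (column k U)))\<^sup>2)" for x
    by (metis cnj_hinner complex_norm_square)
  finally have "0 \<le> Re (quad_form (spec_proj U k) x)" for x by simp
  then show ?thesis
    by (auto simp: psd_def hermitian_def adj_def spec_proj_def vec_eq_iff)
qed

section \<open>Block matrices\<close>

lemma psd_sum:
  fixes M :: "'i \<Rightarrow> complex^'n^'n"
  assumes "\<And>i. i \<in> I \<Longrightarrow> psd (M i)"
  shows "psd (\<Sum>i\<in>I. M i)"
proof -
  have 0: "psd (0 :: complex^'n^'n)"
    by (simp add: psd_def hermitian_def adj_def vec_eq_iff quad_form_def)
  have add: "psd (X + Y)" if "psd X" "psd Y" for X Y :: "complex^'n^'n"
    using that by (auto simp: psd_def hermitian_def adj_def vec_eq_iff quad_form_eq_hinner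
        matrix_vector_mult_add_rdistrib hinner_add)
  show ?thesis
    using assms by (induction I rule: infinite_finite_induct) (auto simp: 0 add)
qed

lemma block_mat_sum:
  "block_mat (\<Sum>i\<in>I. P i) (\<Sum>i\<in>I. Q i) (\<Sum>i\<in>I. R i) (\<Sum>i\<in>I. S i) =
   (\<Sum>i\<in>I. block_mat (P i) (Q i) (R i) (S i))"
  by (auto simp: vec_eq_iff block_mat_def split: sum.split)

lemma sum_UNIV_Plus:
  fixes g :: "'a::finite + 'b::finite \<Rightarrow> 'c::comm_monoid_add"
  shows "(\<Sum>i\<in>UNIV. g i) = (\<Sum>a\<in>UNIV. g (Inl a)) + (\<Sum>b\<in>UNIV. g (Inr b))"
  by (simp add: UNIV_Plus_UNIV[symmetric] sum.Plus del: UNIV_Plus_UNIV)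

lemma quad_form_block_mat:
  fixes x :: "complex^('k::finite + 'k)"
  defines "u \<equiv> \<chi> a. x $ Inl a" and "w \<equiv> \<chi> a. x $ Inr a"
  shows "quad_form (block_mat P Q R S) x =
    hinner u (P *v u) + hinner u (Q *v w) + hinner w (R *v u) + hinner w (S *v w)"
  by (simp add: quad_form_def hinner_def matrix_vector_mult_def sum_UNIV_Plus block_mat_def
      u_def w_def algebra_simps sum.distrib)

lemma mscale_matrix_vector_mult: "(c *m M) *v x = c *s (M *v x)"
  by (simp add: vec_eq_iff mscale_def matrix_vector_mult_def sum_distrib_left mult.assoc)

text \<open>Completing the square: the scalar matrix with rows (t^2, t) and (t, s) is the rank-one
  matrix of the vector (t, 1) plus diag(0, s - 1), and both summands are positive
  semidefinite.\<close>

lemma psd_block_mat_mscale: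
  fixes t s :: real
  assumes M: "psd M" and s: "1 \<le> s"
  shows "psd (block_mat (of_real (t\<^sup>2) *m M) (of_real t *m M) (of_real t *m M) (of_real s *m M))"
    (is "psd ?B")
proof -
  have herm: "cnj (M $ j $ i) = M $ i $ j" for i j
    using M by (auto simp: psd_def hermitian_def adj_def vec_eq_iff)
  have "hermitian ?B"
    by (auto simp: hermitian_def adj_def vec_eq_iff block_mat_def mscale_def herm split: sum.split)
  moreover have "0 \<le> Re (quad_form ?B x)" for x
  proof -
    define u where "u = (\<chi> a. x $ Inl a)"
    define w where "w = (\<chi> a. x $ Inr a)"
    define z where "z = of_real t *s u + w"
    have "quad_form ?B x = quad_form M z + of_real (s - 1) * quad_form M w"
      unfolding quad_form_block_mat u_def[symmetric] w_def[symmetric]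
      by (simp add: z_def quad_form_eq_hinner mscale_matrix_vector_mult matrix_vector_right_distrib
          vector_scalar_commute hinner_add hinner_smult power2_eq_square algebra_simps)
    then show ?thesis using M s by (simp add: psd_def)
  qed
  ultimately show ?thesis by (simp add: psd_def)
qed

theorem theorem3p2:
  fixes \<Phi> :: "complex^'n^'n \<Rightarrow> complex^'k^'k"
    and A :: "complex^'n^'n"
  assumes "positive_unital_linear \<Phi>"
    and "posdef A"
  shows "psd (block_mat (\<Phi> (A ** A)) (\<Phi> A) (\<Phi> A) (\<Phi> (A - mlog A)))"
proof -
  have pos: "\<And>X. psd X \<Longrightarrow> psd (\<Phi> X)" and lin: "Vector_Spaces.linear (*m) (*m) \<Phi>"
    using assms(1) by (auto simp: positive_unital_linear_def)
  interpret \<Phi>: Vector_Spaces.linear "(*m)" "(*m)" \<Phi> by (rule lin)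
  obtain U and d :: "'n \<Rightarrow> real"
    where U: "unitary U" and A: "A = U ** diag (\<lambda>i. complex_of_real (d i)) ** adj U"
      and d: "\<And>i. 0 < d i"
    using posdef_spectral_theorem[OF assms(2)] by metis
  \<comment> \<open>The functional calculus in the fixed eigenbasis of \<open>A\<close>: each of the
    matrices under \<Phi> is \<open>F\<close> of a real function on the indices.\<close>
  define F where "F c = U ** diag (\<lambda>i. complex_of_real (c i)) ** adj U" for c
  have \<Phi>F: "\<Phi> (F c) = (\<Sum>k\<in>UNIV. of_real (c k) *m \<Phi> (spec_proj U k))" for c
    by (simp add: F_def unitary_diag_eq_sum_spec_proj \<Phi>.sum \<Phi>.scale)
  have AF: "A = F d" by (simp add: A F_def)
  have "A ** A = F (\<lambda>i. (d i)\<^sup>2)"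
  proof -
    have UU: "adj U ** U = mat 1" using U by (simp add: unitary_def)
    have "A ** A = U ** (diag (\<lambda>i. of_real (d i)) ** (adj U ** U) ** diag (\<lambda>i. of_real (d i))) ** adj U"
      by (simp add: A matrix_mul_assoc)
    also have "diag (\<lambda>i. of_real (d i)) ** (adj U ** U) ** diag (\<lambda>i. of_real (d i)) =
      diag (\<lambda>i. complex_of_real ((d i)\<^sup>2))"
      unfolding UU matrix_mul_rid
      by (simp add: vec_eq_iff diag_mult_nth) (simp add: diag_def power2_eq_square)
    finally show ?thesis by (simp add: F_def)
  qed
  moreover have "A - mlog A = F (\<lambda>i. d i - ln (d i))"
  proof -
    have "mlog A = F (\<lambda>i. ln (d i))"
      unfolding A F_def by (rule mfun_unitary_diag[OF U])
    then show ?thesis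
      by (simp add: AF F_def unitary_diag_eq_sum_spec_proj vec_eq_iff mscale_def
          algebra_simps sum_subtractf)
  qed
  ultimately have "block_mat (\<Phi> (A ** A)) (\<Phi> A) (\<Phi> A) (\<Phi> (A - mlog A)) =
    (\<Sum>k\<in>UNIV. block_mat (of_real ((d k)\<^sup>2) *m \<Phi> (spec_proj U k)) (of_real (d k) *m \<Phi> (spec_proj U k))
      (of_real (d k) *m \<Phi> (spec_proj U k)) (of_real (d k - ln (d k)) *m \<Phi> (spec_proj U k)))"
    \<comment> \<open>The sum on the right is folded back: first into the blocks, then into values
      of \<Phi> on \<open>F\<close>.\<close>
    unfolding block_mat_sum[symmetric] \<Phi>F[symmetric] AF[symmetric] by simp
  \<comment> \<open>The only property of the logarithm that enters: ln x \<le> x - 1 for positive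
    x.\<close>
  moreover have "1 \<le> d k - ln (d k)" for k
    using ln_le_minus_one[OF d[of k]] by simp
  ultimately show ?thesis
    by (simp only:) (intro psd_sum psd_block_mat_mscale pos psd_spec_proj)
qed

end
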